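(* Let $G$ be a finite nonempty tree with $n$ edges. Then $$n + 1 \leq \sigma(G) \leq 2^n,$$ where $\sigma(G)$ denotes the stringiness of $G$.
   Context: For a finite nonempty connected graph $G$ whose vertices have degrees $d_1 \geq d_2 \geq \dots \geq d_m$ (listed in non-increasing order, where $m$ is the number of vertices), the stringiness of $G$ is $$\sigma(G) = (d_1 + 1)\prod_{i=2}^{m} d_i,$$ the empty product being $1$. *)

theory Defs
  imports "Graph_Theory.Graph_Theory" "HOL-Library.Multiset"
begin

text \<open>
  Undirected simple graphs are the symmetric digraphs of the locale \<^locale>\<open>graph\<close>: the two
  opposite arcs between \<open>u\<close> and \<open>v\<close> together represent one undirected edge.
\<close>

definition undirected_edges :: "('a, 'b) pre_digraph \<Rightarrow> 'a set set" where
  "undirected_edges G = (\<lambda>a. {tail G a, head G a}) ` arcs G"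

text \<open>
  The library's \<^const>\<open>tree\<close> concerns directed cycles, so that traversing an edge back and
  forth counts as a cycle and no symmetric digraph with an edge is a tree in that sense.
  In a symmetric digraph without loops and parallel arcs, the cycles of the underlying
  undirected graph are exactly the directed cycles of length at least 3.
\<close>

definition undirected_tree :: "('a, 'b) pre_digraph \<Rightarrow> bool" where
  "undirected_tree G \<longleftrightarrow>
     graph G \<and> connected G \<and> \<not> (\<exists>p. pre_digraph.cycle G p \<and> length p \<ge> 3)"

text \<open>
  In a \<^locale>\<open>graph\<close> each edge at \<open>v\<close> contributes exactly one arc leaving \<open>v\<close>, so the degree
  of \<open>v\<close> is its out-degree.
\<close>

definition degree_list :: "('a, 'b) pre_digraph \<Rightarrow> nat list" where
  "degree_list G = rev (sorted_list_of_multiset (image_mset (out_degree G) (mset_set (verts G))))"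

text \<open>Only meaningful for finite nonempty graphs: otherwise the degree list is empty.\<close>

definition stringiness :: "('a, 'b) pre_digraph \<Rightarrow> nat" where
  "stringiness G = (hd (degree_list G) + 1) * prod_list (tl (degree_list G))"

end

theory Submission
  imports Defs
begin

text \<open>
  A tree with \<open>n\<close> edges has \<open>n + 1\<close> vertices: grow a connected vertex set one neighbour at a
  time; a new vertex with two neighbours in the set would close a cycle, so each step adds exactly
  one edge. Hence the \<open>n + 1\<close> degrees sum to \<open>2 n\<close>. The lower bound follows from
  \<open>\<Sum> (d\<^sub>i - 1) \<le> \<Prod> d\<^sub>i - 1\<close> for positive \<open>d\<^sub>i\<close>, the upper bound from \<open>d\<^sub>1 + 1 \<le> 2 ^ d\<^sub>1\<close> and
  \<open>2 d\<^sub>i \<le> 2 ^ d\<^sub>i\<close>.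
\<close>

section \<open>Inequalities between sums and products of natural numbers\<close>

lemma prod_list_ge_1:
  fixes xs :: "nat list"
  assumes "0 \<notin> set xs"
  shows "1 \<le> prod_list xs"
  using assms by (induction xs) auto

lemma sum_list_le_prod_list:
  fixes xs :: "nat list"
  assumes "0 \<notin> set xs"
  shows "sum_list xs + 1 \<le> prod_list xs + length xs"
  using assms
proof (induction xs)
  case (Cons x xs)
  then have "1 \<le> prod_list xs" "1 \<le> x"
    using prod_list_ge_1[of xs] by auto
  \<comment> \<open>Since (y + 1) (q + 1) = y + q + 1 + y q, the product gains at least y, while the
    sum minus the length gains exactly y.\<close>
  then obtain y q where "x = Suc y" "prod_list xs = Suc q"
    by (metis One_nat_def Suc_le_D)
  with Cons show ?case by auto
qed simp

lemma double_le_power2: "2 * d \<le> (2::nat) ^ d"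
proof (cases d)
  case (Suc k)
  have "Suc k \<le> 2 ^ k" using less_exp[of k] by (rule Suc_leI)
  then show ?thesis using Suc by simp
qed simp

lemma prod_list_le_power2:
  fixes xs :: "nat list"
  shows "2 ^ length xs * prod_list xs \<le> 2 ^ sum_list xs"
proof (induction xs)
  case (Cons x xs)
  have "2 ^ length (x # xs) * prod_list (x # xs) = (2 * x) * (2 ^ length xs * prod_list xs)"
    by simp
  also have "\<dots> \<le> 2 ^ x * 2 ^ sum_list xs"
    by (intro mult_mono double_le_power2 Cons.IH) auto
  finally show ?case by (simp add: power_add)
qed simp

text \<open>Positivity is asked of the tail only, so that the list [0] of the one-vertex tree is
  covered.\<close>

lemma degree_sequence_bounds:
  fixes xs :: "nat list"
  assumes len: "length xs = n + 1" and sum: "sum_list xs = 2 * n" and pos: "0 \<notin> set (tl xs)"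
  shows "n + 1 \<le> (hd xs + 1) * prod_list (tl xs)" "(hd xs + 1) * prod_list (tl xs) \<le> 2 ^ n"
proof -
  obtain d ds where xs: "xs = d # ds" using len by (cases xs) auto
  have ds: "length ds = n" "d + sum_list ds = 2 * n" "0 \<notin> set ds"
    using assms by (auto simp: xs)
  obtain q where q: "prod_list ds = Suc q"
    using prod_list_ge_1[OF ds(3)] by (metis One_nat_def Suc_le_D)
  \<comment> \<open>As \<open>ds\<close> has length n and sum 2 n - d, the sum-product inequality
    becomes n <= d + q, and d + q + 1 <= (d + 1) (q + 1).\<close>
  show "n + 1 \<le> (hd xs + 1) * prod_list (tl xs)"
    using sum_list_le_prod_list[OF ds(3)] ds by (simp add: xs q)
  \<comment> \<open>Scaling by 2 ^ n provides the factor 2 that each entry of \<open>ds\<close>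
    needs in 2 x <= 2 ^ x; it is cancelled at the end.\<close>
  have "2 ^ n * ((d + 1) * prod_list ds) = (d + 1) * (2 ^ length ds * prod_list ds)"
    unfolding ds(1) by (simp only: mult.left_commute)
  also have "\<dots> \<le> 2 ^ d * 2 ^ sum_list ds"
    using less_exp[of d] by (intro mult_mono prod_list_le_power2) (auto simp: Suc_le_eq)
  also have "\<dots> = 2 ^ n * 2 ^ n"
    using ds(2) by (simp flip: power_add add: mult_2)
  finally show "(hd xs + 1) * prod_list (tl xs) \<le> 2 ^ n"
    by (simp add: xs)
qed

section \<open>Counting arcs, edges and degrees\<close>

context graph
begin

lemma ex_reverse_arc:
  assumes "a \<in> arcs G"
  obtains b where "b \<in> arcs G" "tail G b = head G a" "head G b = tail G a"
  using assms sym_arcs unfolding symmetric_conv by metis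

text \<open>The fibre of an edge consists of an arc and its reverse: there are no parallel arcs, and
  without loops the two differ.\<close>

lemma card_arcs_eq: "card (arcs G) = 2 * card (undirected_edges G)"
proof -
  let ?f = "\<lambda>a. {tail G a, head G a}"
  have "card {x \<in> arcs G. ?f x = e} = 2" if "e \<in> ?f ` arcs G" for e
  proof -
    from that obtain a where a: "a \<in> arcs G" "e = ?f a" by (elim imageE)
    obtain b where b: "b \<in> arcs G" "tail G b = head G a" "head G b = tail G a"
      using ex_reverse_arc[OF a(1)] .
    have "x = a \<or> x = b" if "x \<in> arcs G" "?f x = ?f a" for x
      using that a b no_multi_arcs[of x a] no_multi_arcs[of x b]
      by (auto simp: doubleton_eq_iff arc_to_ends_def)
    then have "{x \<in> arcs G. ?f x = e} = {a, b}"
      using a b by auto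
    moreover have "a \<noteq> b" using a b no_loops by metis
    ultimately show ?thesis by simp
  qed
  then have "(\<Sum>e\<in>?f ` arcs G. card {x \<in> arcs G. ?f x = e}) = 2 * card (?f ` arcs G)"
    by simp
  then show ?thesis
    using sum.image_gen[of "arcs G" "\<lambda>_. 1::nat" ?f] by (simp add: undirected_edges_def)
qed

lemma sum_out_degree: "(\<Sum>v\<in>verts G. out_degree G v) = card (arcs G)"
proof -
  have "arcs G = (\<Union>v\<in>verts G. out_arcs G v)" by auto
  also have "card \<dots> = (\<Sum>v\<in>verts G. out_degree G v)"
    unfolding out_degree_def by (rule card_UN_disjoint) auto
  finally show ?thesis by simp
qed

section \<open>Leaving arcs, cycles and growth of connected vertex sets\<close>

lemma ex_arc_leaving:
  assumes "strongly_connected G" "S \<subset> verts G" "S \<noteq> {}"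
  obtains a where "a \<in> arcs G" "tail G a \<in> S" "head G a \<notin> S"
proof -
  obtain u w where u: "u \<in> S" and w: "w \<in> verts G" "w \<notin> S" using assms by blast
  have "u \<rightarrow>\<^sup>* w" using assms u w by (auto simp: strongly_connected_def)
  \<comment> \<open>A path that starts in S stays in S until it uses an arc crossing the
    boundary.\<close>
  then have "w \<in> S \<or> (\<exists>a\<in>arcs G. tail G a \<in> S \<and> head G a \<notin> S)"
  proof (induction rule: reachable_induct)
    case (step x y)
    then show ?case by (auto simp: arcs_ends_conv)
  qed (use u in auto)
  with w that show ?thesis by blast
qed

lemma out_degree_pos:
  assumes "strongly_connected G" "card (verts G) \<noteq> 1" "v \<in> verts G"
  shows "0 < out_degree G v"
proof -
  have "{v} \<noteq> verts G" using assms(2) by (metis is_singletonI is_singleton_altdef)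
  then obtain a where "a \<in> arcs G" "tail G a = v"
    using ex_arc_leaving[OF assms(1), of "{v}"] assms(3) by auto
  then have "out_arcs G v \<noteq> {}" by auto
  then show ?thesis by (simp add: out_degree_def card_gt_0_iff finite_out_arcs)
qed

text \<open>A path within S between the two neighbours avoids v, so closing it up through v repeats
  no other vertex. The neighbours differ, so the path has an arc and the cycle is longer than a mere
  back-and-forth.\<close>

lemma cycle_of_two_neighbours:
  assumes conn: "strongly_connected (G \<restriction> S)"
    and v: "v \<notin> S"
    and a: "a \<in> arcs G" "tail G a = v" "head G a \<in> S"
    and b: "b \<in> arcs G" "tail G b \<in> S" "head G b = v"
    and neq: "head G a \<noteq> tail G b"
  shows "\<exists>p. cycle p \<and> 3 \<le> length p"
proof -
  interpret H: wf_digraph "G \<restriction> S" by (rule wellformed_induce_subgraph)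
  obtain p where p: "pre_digraph.apath (G \<restriction> S) (head G a) p (tail G b)"
  proof -
    have "head G a \<rightarrow>\<^sup>*\<^bsub>G \<restriction> S\<^esub> tail G b"
      using conn a(3) b(2) by (simp add: strongly_connected_def)
    then show thesis using that unfolding H.reachable_apath by blast
  qed
  have p_ne: "p \<noteq> []" using p neq by (auto simp: H.apath_Nil_iff)
  have sub: "set (awalk_verts (head G a) p) \<subseteq> S"
    using H.awalkE[OF H.awalkI_apath[OF p]] by (auto simp: awalk_verts_induce)
  have dist: "distinct (awalk_verts (head G a) p)"
    using p by (simp add: awalk_verts_induce H.apath_def)
  have walk_p: "awalk (head G a) p (tail G b)"
  proof -
    have "set p \<subseteq> arcs G" "H.cas (head G a) p (tail G b)"
      using H.awalkI_apath[OF p] by (auto simp: H.awalk_def)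
    then show ?thesis
      using a(1) compatible_cas[OF compatible_induce_subgraph, of G S] by (simp add: awalk_def)
  qed
  have walk: "awalk v (a # p @ [b]) v"
    using a b walk_p by (auto simp: awalk_simps)
  \<comment> \<open>The closed walk lists v at both ends; \<open>cycle\<close> asks for distinctness
    only after the first entry is dropped.\<close>
  have "tl (awalk_verts v (a # p @ [b])) = awalk_verts (head G a) p @ [v]"
  proof -
    have "awlast (head G a) p = tail G b" using walk_p by auto
    with p_ne have "head G (last p) = tail G b" by (simp add: awalk_verts_conv)
    then show ?thesis using p_ne b by (simp add: awalk_verts_conv)
  qed
  then have "cycle (a # p @ [b])"
    using walk dist sub v by (auto simp: cycle_def)
  moreover have "3 \<le> length (a # p @ [b])" using p_ne by (cases p) auto
  ultimately show ?thesis by blast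
qed

lemma strongly_connected_insert:
  assumes conn: "strongly_connected (G \<restriction> S)"
    and a: "a \<in> arcs G" "tail G a \<in> S" "head G a = v"
  shows "strongly_connected (G \<restriction> insert v S)"
proof -
  interpret H: wf_digraph "G \<restriction> insert v S" by (rule wellformed_induce_subgraph)
  obtain b where b: "b \<in> arcs G" "tail G b = v" "head G b = tail G a"
    using ex_reverse_arc[OF a(1)] a by metis
  have old: "x \<rightarrow>\<^sup>*\<^bsub>G \<restriction> insert v S\<^esub> y" if "x \<in> S" "y \<in> S" for x y
    using conn that reachable_induce_ss[of S x y "insert v S"] by (auto simp: strongly_connected_def)
  have av: "tail G a \<rightarrow>\<^bsub>G \<restriction> insert v S\<^esub> v" and va: "v \<rightarrow>\<^bsub>G \<restriction> insert v S\<^esub> tail G a"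
    using a b by (force simp: arcs_ends_conv)+
  \<comment> \<open>The neighbour \<open>tail G a\<close> is a hub: any two vertices are joined
    through it.\<close>
  have "x \<rightarrow>\<^sup>*\<^bsub>G \<restriction> insert v S\<^esub> tail G a" "tail G a \<rightarrow>\<^sup>*\<^bsub>G \<restriction> insert v S\<^esub> x"
    if "x \<in> insert v S" for x
    using that old a(2) H.reachable_adjI[OF av] H.reachable_adjI[OF va] by auto
  then show ?thesis
    by (intro strongly_connectedI) (auto intro: H.reachable_trans)
qed

lemma undirected_edges_insert:
  assumes a: "a \<in> arcs G" "tail G a \<in> S" "head G a = v"
    and only: "\<And>b. \<lbrakk>b \<in> arcs G; tail G b \<in> S; head G b = v\<rbrakk> \<Longrightarrow> tail G b = tail G a"
  shows "undirected_edges (G \<restriction> insert v S) = insert {tail G a, v} (undirected_edges (G \<restriction> S))"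
    (is "?L = ?R")
proof
  show "?L \<subseteq> ?R"
  proof
    fix e assume "e \<in> ?L"
    then obtain b where b: "b \<in> arcs G" "tail G b \<in> insert v S" "head G b \<in> insert v S"
      and e: "e = {tail G b, head G b}" by (auto simp: undirected_edges_def)
    \<comment> \<open>The arc chosen for the edge may leave v, whereas \<open>only\<close> concerns
      arcs entering v; then the reverse arc is used.\<close>
    obtain c where c: "c \<in> arcs G" "tail G c = head G b" "head G c = tail G b"
      using ex_reverse_arc[OF b(1)] .
    consider "tail G b = v" "head G b \<in> S" | "tail G b \<in> S" "head G b = v"
      | "tail G b \<in> S" "head G b \<in> S"
      using b no_loops[of b] by auto
    then show "e \<in> ?R"
    proof cases
      case 1
      then show ?thesis using only[of c] c e by auto
    next
      case 2
      then show ?thesis using only[of b] b e by auto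
    next
      case 3
      then show ?thesis using b e by (auto simp: undirected_edges_def)
    qed
  qed
  show "?R \<subseteq> ?L"
    using a by (auto simp: undirected_edges_def)
qed

lemma card_verts_eq_Suc_edges:
  assumes conn: "strongly_connected G" and acyc: "\<nexists>p. cycle p \<and> 3 \<le> length p"
  shows "card (verts G) = card (undirected_edges G) + 1"
proof -
  \<comment> \<open>Vertices and edges are counted together as S grows; for the largest admissible
    k, S is the whole vertex set.\<close>
  have "\<exists>S \<subseteq> verts G. card S = Suc k \<and> strongly_connected (G \<restriction> S) \<and>
      card (undirected_edges (G \<restriction> S)) = k" if "Suc k \<le> card (verts G)" for k
    using that
  proof (induction k)
    case 0
    obtain r where r: "r \<in> verts G" using conn by (auto simp: strongly_connected_def)
    interpret H: wf_digraph "G \<restriction> {r}" by (rule wellformed_induce_subgraph)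
    have "arcs (G \<restriction> {r}) = {}" using no_loops by force
    then have "undirected_edges (G \<restriction> {r}) = {}" by (simp add: undirected_edges_def)
    with r show ?case
      by (intro exI[of _ "{r}"]) auto
  next
    case (Suc k)
    then obtain S where S: "S \<subseteq> verts G" "card S = Suc k" "strongly_connected (G \<restriction> S)"
      "card (undirected_edges (G \<restriction> S)) = k" by auto
    have finS: "finite S" using S(1) finite_verts by (rule finite_subset)
    have "S \<subset> verts G" "S \<noteq> {}" using S Suc.prems by auto
    then obtain a where a: "a \<in> arcs G" "tail G a \<in> S" "head G a \<notin> S"
      using ex_arc_leaving[OF conn] by blast
    let ?v = "head G a"
    have only: "tail G b = tail G a" if b: "b \<in> arcs G" "tail G b \<in> S" "head G b = ?v" for b
    proof (rule ccontr)
      assume neq: "tail G b \<noteq> tail G a"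
      \<comment> \<open>The cycle leaves the new vertex along c, towards \<open>tail G a\<close>,
        and returns to it along b.\<close>
      obtain c where c: "c \<in> arcs G" "tail G c = ?v" "head G c = tail G a"
        using ex_reverse_arc[OF a(1)] .
      show False
        using cycle_of_two_neighbours[OF S(3) a(3), of c b] a b c neq acyc by auto
    qed
    have "{tail G a, ?v} \<notin> undirected_edges (G \<restriction> S)"
      using a by (auto simp: undirected_edges_def doubleton_eq_iff)
    moreover have "finite (undirected_edges (G \<restriction> S))"
      by (auto simp: undirected_edges_def)
    moreover have "undirected_edges (G \<restriction> insert ?v S)
        = insert {tail G a, ?v} (undirected_edges (G \<restriction> S))"
      using a(1,2) refl only by (rule undirected_edges_insert)
    ultimately have "card (undirected_edges (G \<restriction> insert ?v S)) = Suc k"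
      using S(4) by simp
    moreover have "strongly_connected (G \<restriction> insert ?v S)"
      by (rule strongly_connected_insert[OF S(3) a(1,2) refl])
    ultimately show ?case
      using S(1,2) a(1,3) finS by (intro exI[of _ "insert ?v S"]) simp
  qed
  moreover obtain m where "card (verts G) = Suc m"
    using conn by (cases "card (verts G)") (auto simp: strongly_connected_def)
  ultimately obtain S where S: "S \<subseteq> verts G" "card S = card (verts G)"
    "card (undirected_edges (G \<restriction> S)) + 1 = card (verts G)"
    by (metis Suc_eq_plus1 order_refl)
  have "S = verts G" using finite_verts S(1,2) by (rule card_subset_eq)
  moreover have "undirected_edges (G \<restriction> verts G) = undirected_edges G"
    by (force simp: undirected_edges_def)
  ultimately show ?thesis using S by simp
qed

end

section \<open>From the graph to its degree list\<close>

lemma mset_degree_list: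
  "mset (degree_list G) = image_mset (out_degree G) (mset_set (verts G))"
  by (simp add: degree_list_def)

theorem theorem1p5:
  fixes G :: "('a, 'b) pre_digraph" and n :: nat
  assumes "undirected_tree G"
    and "card (undirected_edges G) = n"
  shows "n + 1 \<le> stringiness G \<and> stringiness G \<le> 2 ^ n"
proof -
  interpret graph G using assms(1) by (simp add: undirected_tree_def)
  have conn: "strongly_connected G"
    using assms(1) symmetric_connected_imp_strongly_connected[OF sym_arcs]
    by (simp add: undirected_tree_def)
  have card: "card (verts G) = n + 1"
    using card_verts_eq_Suc_edges[OF conn] assms by (auto simp: undirected_tree_def)
  let ?ds = "degree_list G"
  \<comment> \<open>Length, sum and set of entries ignore the order, so all three are read off the
    multiset of degrees.\<close>
  have len: "length ?ds = n + 1"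
    using arg_cong[OF mset_degree_list[of G], of size] card by simp
  have sum: "sum_list ?ds = 2 * n"
    using arg_cong[OF mset_degree_list[of G], of sum_mset] sum_out_degree card_arcs_eq assms(2)
    by (simp add: sum_mset_sum_list sum_unfold_sum_mset)
  have pos: "0 \<notin> set (tl ?ds)"
  \<comment> \<open>For n = 0 the only vertex has degree 0, but the tail is empty; otherwise every
    degree is positive by connectedness.\<close>
  proof (cases "n = 0")
    case True
    then show ?thesis using len by (cases ?ds) auto
  next
    case False
    have "set ?ds = out_degree G ` verts G"
      using arg_cong[OF mset_degree_list[of G], of set_mset] by simp
    then have "0 \<notin> set ?ds"
      using out_degree_pos[OF conn] card False by force
    then show ?thesis by (cases ?ds) auto
  qed
  show ?thesis
    using degree_sequence_bounds[OF len sum pos] by (simp add: stringiness_def)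
qed

end
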